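(* Suppose the Ramsey number $R_{\mathbb{G}}(\mathbb{X},\mathcal{C})$ (maximal base $\mathbb{G}=\{G_i\}_{i\in I}$, uniform symbol $\mathbb{X}=\{X_j\}_{j\in J}$, $\mathcal{C}=\{\psi_j\}_{j\in J}$) is of Galois type with $q$ colors, and suppose $\mathbb{G}$ admits an $\mathbb{X}$-resolution with $\mathrm{res}_{\mathbb{X}}(\mathbb{G})=\mathbb{G}_{\ge k}$. Then for all $n>k$ in $I$ and all $\pi\in G_n/G_k$, the polynomial obtained from $p[G_k,\mathbb{X},\mathcal{C}]\in\mathbb{F}_q[x_f:f\in E(G_k)]$ by substituting $x_{\pi^{-1}(f)}$ for $x_f$ (for each $f\in E(G_k)$) is a factor of $p[G_n,\mathbb{X},\mathcal{C}](x)$ in $\mathbb{F}_q[x_e:e\in E(G_n)]$.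
   Context: All graphs are finite and undirected. $\mathrm{Hom}(G,A)$ is the set of maps $E(G)\to A$. The isomorphism set $G/X$ is the set of edge maps $\pi:E(Y)\to E(X)$ induced by graph isomorphisms $V(Y)\to V(X)$, $Y$ ranging over subgraphs of $G$; $\pi^{-1}(X)$ denotes $Y$ (or $E(Y)$), and for $f\in E(X)$, $\pi^{-1}(f)$ is the edge of $Y$ mapped to $f$. Index sets $I$ are strictly well-ordered with least element $0$; $I_{\ge k}=\{t\in I:k\le t\}$, $T_{\ge k}$ the corresponding subfamily. $\mathbb{X}\unlhd\mathbb{G}$ (constituent) means $G_i/X_j\ne\emptyset$ for all $i,j$; $\mathbb{G}$ is hereditary if for all $0<i\le k$ in $I$, $\{G_s:s<i\}\unlhd\mathbb{G}_{\ge k}$. Setting: $\mathbb{G}=\{G_i\}_{i\in I}$ is hereditary and the base is maximal with finite color set $A$: the admissible colorings at index $i$ are all of $\mathrm{Hom}(G_i,A)$. The symbol is uniform of finite type: a fixed finite family $\mathbb{X}=\{X_j\}_{j\in J}$ with $\psi_j\in\mathrm{Hom}(X_j,A)$ used at every index, and $\coprod_j X_j$ constant (hereditary). Galois type means additionally $|A|=q$ is a prime power; $A$ is identified with $\mathbb{F}_q$. (The Ramsey number $R_{\mathbb{G}}(\mathbb{X},\mathcal{C})$ is the least $n\in I$ such that for all $t\ge n$ and all $\rho\in\mathrm{Hom}(G_t,A)$ there are $j\in J$, $\pi\in G_t/X_j$ with $\rho(e)=\psi_j(\pi(e))$ for all edges $e$ of $\pi^{-1}(X_j)$.) $\mathbb{G}$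 admits an $\mathbb{X}$-resolution if there is a minimum $k\in I$ such that $\mathbb{V}\unlhd\mathbb{G}_{\ge k}$ for some nonempty $\mathbb{V}\subseteq\mathbb{X}$; then $\mathrm{res}_{\mathbb{X}}(\mathbb{G})=\mathbb{G}_{\ge k}$. Indicator polynomials: for $\psi\in\mathrm{Hom}(X,\mathbb{F}_q)$, $p[G,X,\psi](x)=\prod_{\pi\in G/X}\big(1-\prod_{e\in\pi^{-1}(X)}(1-(x_e-\psi(\pi(e)))^{q-1})\big)\in\mathbb{F}_q[x_e:e\in E(G)]$, and $p[G,\mathbb{X},\mathcal{C}]=\prod_{j\in J}p[G,X_j,\psi_j]$. *)

theory Defs
  imports Main "HOL-Library.FuncSet" "HOL-Library.Cardinality" "HOL-Library.Poly_Mapping"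
begin

section \<open>Finite undirected graphs\<close>

text \<open>An edge is the set of its endpoints, so loops \<open>{u}\<close> are possible but parallel edges are
  not; a graph isomorphism on vertices therefore induces a unique map on edges.\<close>

record 'v ugraph =
  verts :: "'v set"
  edges :: "'v set set"

definition is_graph :: "'v ugraph \<Rightarrow> bool" where
  "is_graph G \<longleftrightarrow>
     finite (verts G) \<and> (\<forall>e\<in>edges G. \<exists>u\<in>verts G. \<exists>v\<in>verts G. e = {u, v})"

definition is_subgraph :: "'v ugraph \<Rightarrow> 'v ugraph \<Rightarrow> bool" where
  "is_subgraph Y G \<longleftrightarrow> is_graph Y \<and> verts Y \<subseteq> verts G \<and> edges Y \<subseteq> edges G"

definition graph_iso :: "'v ugraph \<Rightarrow> 'w ugraph \<Rightarrow> ('v \<Rightarrow> 'w) \<Rightarrow> bool" where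
  "graph_iso Y X \<phi> \<longleftrightarrow>
     bij_betw \<phi> (verts Y) (verts X) \<and>
     (\<forall>u\<in>verts Y. \<forall>v\<in>verts Y. {u, v} \<in> edges Y \<longleftrightarrow> {\<phi> u, \<phi> v} \<in> edges X)"

definition induced_edge_map :: "'v ugraph \<Rightarrow> ('v \<Rightarrow> 'w) \<Rightarrow> 'v set \<rightharpoonup> 'w set" where
  "induced_edge_map Y \<phi> = (\<lambda>e. if e \<in> edges Y then Some (\<phi> ` e) else None)"

text \<open>The isomorphism set \<open>G/X\<close>. Its members are partial maps on edges, so that
  \<open>dom \<pi>\<close> is the edge set of \<open>\<pi>\<inverse>(X)\<close>; vertex isomorphisms inducing the same
  edge map are not distinguished.\<close>

definition iso_set :: "'v ugraph \<Rightarrow> 'w ugraph \<Rightarrow> ('v set \<rightharpoonup> 'w set) set" where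
  "iso_set G X = {induced_edge_map Y \<phi> | Y \<phi>. is_subgraph Y G \<and> graph_iso Y X \<phi>}"

definition edge_preimage :: "('v set \<rightharpoonup> 'w set) \<Rightarrow> 'w set \<Rightarrow> 'v set" where
  "edge_preimage \<pi> f = (THE e. \<pi> e = Some f)"

definition Hom :: "'v ugraph \<Rightarrow> 'a set \<Rightarrow> ('v set \<Rightarrow> 'a) set" where
  "Hom G A = edges G \<rightarrow>\<^sub>E A"


section \<open>Families of graphs\<close>

text \<open>A family is given by an index set and a function on it; subfamilies are obtained by
  restricting the index set.\<close>

definition constituent ::
    "'j set \<Rightarrow> ('j \<Rightarrow> 'w ugraph) \<Rightarrow> 'i set \<Rightarrow> ('i \<Rightarrow> 'v ugraph) \<Rightarrow> bool" where
  "constituent J X I G \<longleftrightarrow> (\<forall>i\<in>I. \<forall>j\<in>J. iso_set (G i) (X j) \<noteq> {})"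

definition index_ge :: "'i::wellorder set \<Rightarrow> 'i \<Rightarrow> 'i set" where
  "index_ge I k = {t \<in> I. k \<le> t}"

definition hereditary :: "'i::wellorder set \<Rightarrow> ('i \<Rightarrow> 'v ugraph) \<Rightarrow> bool" where
  "hereditary I G \<longleftrightarrow>
     (\<forall>i\<in>I. \<forall>k\<in>I. (LEAST t. t \<in> I) < i \<and> i \<le> k \<longrightarrow>
        constituent {s \<in> I. s < i} G (index_ge I k) G)"

text \<open>The family \<open>{G i | i \<in> I}\<close> admits an \<open>X\<close>-resolution iff some \<open>k\<close> satisfies the
  following predicate; the resolution is then the subfamily indexed by \<open>index_ge I k\<close>.\<close>

definition resolution_index ::
    "'i::wellorder set \<Rightarrow> ('i \<Rightarrow> 'v ugraph) \<Rightarrow> 'j set \<Rightarrow> ('j \<Rightarrow> 'w ugraph) \<Rightarrow> 'i \<Rightarrow> bool" where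
  "resolution_index I G J X k \<longleftrightarrow>
     (let P = (\<lambda>k. \<exists>V\<subseteq>J. V \<noteq> {} \<and> constituent V X (index_ge I k) G)
      in k \<in> I \<and> P k \<and> (\<forall>k'\<in>I. P k' \<longrightarrow> k \<le> k'))"


section \<open>Multivariate polynomials\<close>

text \<open>Monomials are finitely supported exponent functions, polynomials are finitely supported
  functions from monomials to coefficients, with the convolution product of
  \<open>Poly_Mapping\<close>.\<close>

type_synonym ('x, 'a) mpoly = "('x \<Rightarrow>\<^sub>0 nat) \<Rightarrow>\<^sub>0 'a"

definition Var :: "'x \<Rightarrow> ('x, 'a::comm_ring_1) mpoly" where
  "Var x = Poly_Mapping.single (Poly_Mapping.single x 1) 1"

definition Const :: "'a \<Rightarrow> ('x, 'a::comm_ring_1) mpoly" where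
  "Const c = Poly_Mapping.single 0 c"

definition polys_in :: "'x set \<Rightarrow> ('x, 'a::comm_ring_1) mpoly set" where
  "polys_in E = {p. \<forall>m\<in>Poly_Mapping.keys p. Poly_Mapping.keys m \<subseteq> E}"

definition subst_vars ::
    "('x \<Rightarrow> ('y, 'a) mpoly) \<Rightarrow> ('x, 'a::comm_ring_1) mpoly \<Rightarrow> ('y, 'a) mpoly" where
  "subst_vars s p =
     (\<Sum>m\<in>Poly_Mapping.keys p. Const (Poly_Mapping.lookup p m) *
        (\<Prod>x\<in>Poly_Mapping.keys m. s x ^ Poly_Mapping.lookup m x))"

text \<open>Divisibility inside the subring \<open>polys_in E\<close>, i.e. with the cofactor in that subring.\<close>

definition factor_in :: "'x set \<Rightarrow> ('x, 'a::comm_ring_1) mpoly \<Rightarrow> ('x, 'a) mpoly \<Rightarrow> bool" where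
  "factor_in E p r \<longleftrightarrow> p \<in> polys_in E \<and> r \<in> polys_in E \<and> (\<exists>s\<in>polys_in E. r = p * s)"


section \<open>Indicator polynomials\<close>

text \<open>The colour set is a finite field, given as a type \<open>'a\<close>; thus \<open>q = CARD('a)\<close>.\<close>

definition indicator_poly ::
    "'v ugraph \<Rightarrow> 'w ugraph \<Rightarrow> ('w set \<Rightarrow> 'a::{field,finite}) \<Rightarrow> ('v set, 'a) mpoly" where
  "indicator_poly G X \<psi> =
     (\<Prod>\<pi>\<in>iso_set G X.
        1 - (\<Prod>e\<in>dom \<pi>. 1 - (Var e - Const (\<psi> (the (\<pi> e)))) ^ (CARD('a) - 1)))"

definition indicator_poly_family ::
    "'v ugraph \<Rightarrow> 'j set \<Rightarrow> ('j \<Rightarrow> 'w ugraph) \<Rightarrow> ('j \<Rightarrow> 'w set \<Rightarrow> 'a::{field,finite})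
      \<Rightarrow> ('v set, 'a) mpoly" where
  "indicator_poly_family G J X \<psi> = (\<Prod>j\<in>J. indicator_poly G (X j) (\<psi> j))"

end

theory Submission
  imports Defs
begin

text \<open>Composition with \<open>\<pi> \<in> G\<^sub>n/G\<^sub>k\<close> embeds \<open>G\<^sub>k/X\<close> into
  \<open>G\<^sub>n/X\<close>, and the substitution \<open>x\<^sub>f \<mapsto> x\<close> at \<open>\<pi>\<inverse>(f)\<close> turns the factor
  of \<open>p[G\<^sub>k,X,\<psi>]\<close> belonging to \<open>\<sigma>\<close> into the factor of \<open>p[G\<^sub>n,X,\<psi>]\<close> belonging to
  \<open>\<sigma> \<circ> \<pi>\<close>. So the substituted polynomial is a subproduct of the larger one.\<close>

section \<open>Isomorphism sets\<close>

lemma iso_setE: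
  assumes "\<pi> \<in> iso_set G X"
  obtains Y \<phi> where "\<pi> = induced_edge_map Y \<phi>" "is_subgraph Y G" "graph_iso Y X \<phi>"
  using assms unfolding iso_set_def by blast

lemma dom_induced_edge_map [simp]: "dom (induced_edge_map Y \<phi>) = edges Y"
  by (auto simp: induced_edge_map_def dom_def)

lemma is_graph_edgeE:
  assumes "is_graph G" "e \<in> edges G"
  obtains u v where "u \<in> verts G" "v \<in> verts G" "e = {u, v}"
  using assms unfolding is_graph_def by blast

lemma is_graph_edge_subset: "is_graph G \<Longrightarrow> e \<in> edges G \<Longrightarrow> e \<subseteq> verts G"
  by (erule is_graph_edgeE) auto

lemma is_graph_finite_edges:
  assumes "is_graph G" shows "finite (edges G)"
proof (rule finite_subset)
  show "edges G \<subseteq> Pow (verts G)"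
    using is_graph_edge_subset[OF assms] by blast
  show "finite (Pow (verts G))"
    using assms by (simp add: is_graph_def)
qed

lemma iso_set_dom: "\<pi> \<in> iso_set G X \<Longrightarrow> dom \<pi> \<subseteq> edges G"
  by (erule iso_setE) (simp add: is_subgraph_def)

text \<open>Edges are subsets of the vertex set, and a map injective on vertices has an injective
  image map on such subsets.\<close>

lemma iso_set_inj_on:
  assumes "\<pi> \<in> iso_set G X"
  shows "inj_on \<pi> (dom \<pi>)"
proof -
  obtain Y \<phi> where \<pi>: "\<pi> = induced_edge_map Y \<phi>" and Y: "is_subgraph Y G" "graph_iso Y X \<phi>"
    using assms by (rule iso_setE)
  have sub: "e \<subseteq> verts Y" if "e \<in> edges Y" for e
    using Y(1) that is_graph_edge_subset unfolding is_subgraph_def by blast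
  have "inj_on \<phi> (verts Y)"
    using Y(2) by (simp add: graph_iso_def bij_betw_def)
  then have "e = e'" if "e \<in> edges Y" "e' \<in> edges Y" "\<phi> ` e = \<phi> ` e'" for e e'
    using that sub by (metis inj_on_image_eq_iff)
  then show ?thesis
    by (auto simp: \<pi> induced_edge_map_def inj_on_def split: if_splits)
qed

text \<open>\<open>graph_iso\<close> speaks only of pairs of vertices. \<open>is_graph X\<close>
  makes every edge of \<open>X\<close> such a pair, so it can be pulled back along the vertex
  bijection.\<close>

lemma iso_set_ran:
  assumes "\<pi> \<in> iso_set G X" "is_graph X"
  shows "ran \<pi> = edges X"
proof -
  obtain Y \<phi> where \<pi>: "\<pi> = induced_edge_map Y \<phi>" and Y: "is_subgraph Y G" "graph_iso Y X \<phi>"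
    using assms(1) by (rule iso_setE)
  have gY: "is_graph Y"
    using Y(1) by (simp add: is_subgraph_def)
  have iso: "{u, v} \<in> edges Y \<longleftrightarrow> {\<phi> u, \<phi> v} \<in> edges X" if "u \<in> verts Y" "v \<in> verts Y" for u v
    using Y(2) that by (simp add: graph_iso_def)
  have surj: "verts X = \<phi> ` verts Y"
    using Y(2) by (simp add: graph_iso_def bij_betw_def)
  have "ran \<pi> = (`) \<phi> ` edges Y"
    by (auto simp: \<pi> induced_edge_map_def ran_def)
  also have "\<dots> = edges X"
  proof (intro equalityI subsetI)
    fix f assume "f \<in> (`) \<phi> ` edges Y"
    then obtain e where e: "e \<in> edges Y" "f = \<phi> ` e" by blast
    from gY e(1) obtain u v where "u \<in> verts Y" "v \<in> verts Y" "e = {u, v}"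
      by (rule is_graph_edgeE)
    with e iso show "f \<in> edges X" by auto
  next
    fix f assume f: "f \<in> edges X"
    with assms(2) obtain a b where "a \<in> verts X" "b \<in> verts X" "f = {a, b}"
      by (rule is_graph_edgeE)
    moreover from this obtain u v where "u \<in> verts Y" "v \<in> verts Y" "a = \<phi> u" "b = \<phi> v"
      using surj by blast
    ultimately have "{u, v} \<in> edges Y" "f = \<phi> ` {u, v}"
      using iso f by auto
    then show "f \<in> (`) \<phi> ` edges Y" by blast
  qed
  finally show ?thesis .
qed

text \<open>Finitely many domains and a finite range leave finitely many partial maps. Splitting the
  product over \<open>iso_set G X\<close> depends on this, since an infinite product is 1 by
  convention.\<close>

lemma finite_iso_set:
  assumes "is_graph G" "is_graph X"
  shows "finite (iso_set G X)"
proof (rule finite_subset)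
  let ?M = "\<lambda>D. {\<pi>. dom \<pi> = D \<and> ran \<pi> \<subseteq> edges X}"
  show "iso_set G X \<subseteq> (\<Union>D\<in>Pow (edges G). ?M D)"
  proof
    fix \<pi> assume "\<pi> \<in> iso_set G X"
    then have "dom \<pi> \<in> Pow (edges G)" "ran \<pi> = edges X"
      using iso_set_dom iso_set_ran[OF _ assms(2)] by simp_all
    then show "\<pi> \<in> (\<Union>D\<in>Pow (edges G). ?M D)" by simp
  qed
  have "finite (edges G)" "finite (edges X)"
    using assms by (simp_all add: is_graph_finite_edges)
  moreover have "finite (?M D)" if "D \<in> Pow (edges G)" for D
    using that calculation by (intro finite_set_of_finite_maps) (auto intro: finite_subset)
  ultimately show "finite (\<Union>D\<in>Pow (edges G). ?M D)"
    by (intro finite_UN_I) simp_all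
qed

lemma iso_set_comp:
  assumes "\<sigma> \<in> iso_set H X" "\<pi> \<in> iso_set G H"
  shows "\<sigma> \<circ>\<^sub>m \<pi> \<in> iso_set G X"
proof -
  obtain Y \<phi> where \<pi>: "\<pi> = induced_edge_map Y \<phi>" and Y: "is_subgraph Y G" "graph_iso Y H \<phi>"
    using assms(2) by (rule iso_setE)
  obtain Z \<chi> where \<sigma>: "\<sigma> = induced_edge_map Z \<chi>" and Z: "is_subgraph Z H" "graph_iso Z X \<chi>"
    using assms(1) by (rule iso_setE)
  \<comment> \<open>\<open>W\<close> is the preimage of \<open>Z\<close> under \<phi> inside
    \<open>Y\<close>: exactly the part of \<open>Y\<close> on which \<chi> can be applied after
    \<phi>.\<close>
  define W where
    "W = \<lparr>verts = {v \<in> verts Y. \<phi> v \<in> verts Z}, edges = {e \<in> edges Y. \<phi> ` e \<in> edges Z}\<rparr>"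
  have gY: "is_graph Y" and gZ: "is_graph Z"
    using Y(1) Z(1) by (simp_all add: is_subgraph_def)
  have bij\<phi>: "bij_betw \<phi> (verts Y) (verts H)" and bij\<chi>: "bij_betw \<chi> (verts Z) (verts X)"
    using Y(2) Z(2) by (simp_all add: graph_iso_def)
  have "is_graph W"
    unfolding is_graph_def
  proof (intro conjI ballI)
    show "finite (verts W)"
      using gY by (simp add: W_def is_graph_def)
    fix e assume "e \<in> edges W"
    then have e: "e \<in> edges Y" "\<phi> ` e \<in> edges Z" by (simp_all add: W_def)
    from gY e(1) obtain u v where uv: "u \<in> verts Y" "v \<in> verts Y" "e = {u, v}"
      by (rule is_graph_edgeE)
    have "\<phi> ` e \<subseteq> verts Z"
      using gZ e(2) by (rule is_graph_edge_subset)
    with uv show "\<exists>u\<in>verts W. \<exists>v\<in>verts W. e = {u, v}"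
      by (auto simp: W_def)
  qed
  then have sub: "is_subgraph W G"
    using Y(1) by (auto simp: is_subgraph_def W_def)
  \<comment> \<open>Surjectivity holds because the vertices of \<open>Z\<close> lie in
    \<open>H\<close>, which is the image of \<open>Y\<close>.\<close>
  have "bij_betw \<phi> (verts W) (verts Z)"
    using bij\<phi> Z(1) by (fastforce simp: bij_betw_def inj_on_def is_subgraph_def W_def)
  then have bij: "bij_betw (\<chi> \<circ> \<phi>) (verts W) (verts X)"
    using bij\<chi> by (rule bij_betw_trans)
  \<comment> \<open>Every edge of \<open>Z\<close> is an edge of \<open>H\<close>, so its preimage
    pair is already an edge of \<open>Y\<close>; membership in \<open>edges W\<close> reduces to
    membership of the image in \<open>edges Z\<close>.\<close>
  have "{u, v} \<in> edges W \<longleftrightarrow> {(\<chi> \<circ> \<phi>) u, (\<chi> \<circ> \<phi>) v} \<in> edges X"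
    if "u \<in> verts W" "v \<in> verts W" for u v
    using that Y(2) Z by (auto simp: W_def graph_iso_def is_subgraph_def)
  with bij have "graph_iso W X (\<chi> \<circ> \<phi>)"
    by (simp add: graph_iso_def)
  moreover have "\<sigma> \<circ>\<^sub>m \<pi> = induced_edge_map W (\<chi> \<circ> \<phi>)"
    by (auto simp: \<sigma> \<pi> W_def induced_edge_map_def map_comp_def image_comp)
  ultimately show ?thesis
    using sub unfolding iso_set_def by blast
qed

text \<open>Injectivity of \<pi> on its domain makes the description in \<open>edge_preimage\<close>
  unique; existence comes from \<open>iso_set_ran\<close> in the next lemma.\<close>

lemma edge_preimage_eq:
  assumes "\<pi> \<in> iso_set G X" "\<pi> e = Some f"
  shows "edge_preimage \<pi> f = e"
  unfolding edge_preimage_def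
proof (rule the_equality)
  fix e' assume "\<pi> e' = Some f"
  then show "e' = e"
    using iso_set_inj_on[OF assms(1)] assms(2) by (metis domI inj_onD)
qed (fact assms(2))

lemma map_edge_preimage:
  assumes "\<pi> \<in> iso_set G X" "is_graph X" "f \<in> edges X"
  shows "\<pi> (edge_preimage \<pi> f) = Some f"
proof -
  obtain e where "\<pi> e = Some f"
    using iso_set_ran[OF assms(1,2)] assms(3) by (auto simp: ran_def)
  with assms(1) show ?thesis by (simp add: edge_preimage_eq)
qed

text \<open>Since \<pi> reaches every edge of \<open>H\<close>, the composite determines \<sigma> on
  \<open>edges H\<close>, and outside that set \<sigma> is undefined.\<close>

lemma inj_on_iso_set_comp:
  assumes "\<pi> \<in> iso_set G H" "is_graph H"
  shows "inj_on (\<lambda>\<sigma>. \<sigma> \<circ>\<^sub>m \<pi>) (iso_set H X)"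
proof (rule inj_onI, rule ext)
  fix \<sigma> \<sigma>' f
  assume \<sigma>: "\<sigma> \<in> iso_set H X" and \<sigma>': "\<sigma>' \<in> iso_set H X" and eq: "\<sigma> \<circ>\<^sub>m \<pi> = \<sigma>' \<circ>\<^sub>m \<pi>"
  show "\<sigma> f = \<sigma>' f"
  proof (cases "f \<in> edges H")
    case True
    then have "\<pi> (edge_preimage \<pi> f) = Some f"
      by (rule map_edge_preimage[OF assms])
    with fun_cong[OF eq, of "edge_preimage \<pi> f"] show ?thesis
      by (simp add: map_comp_def)
  next
    case False
    then have "f \<notin> dom \<sigma>" "f \<notin> dom \<sigma>'"
      using iso_set_dom[OF \<sigma>] iso_set_dom[OF \<sigma>'] by auto
    then show ?thesis by (simp add: domIff)
  qed
qed

text \<open>This is the change of index for the inner product over edges in an indicator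
  polynomial.\<close>

lemma bij_betw_edge_preimage_comp:
  assumes "\<sigma> \<in> iso_set H X" "\<pi> \<in> iso_set G H" "is_graph H"
  shows "bij_betw (edge_preimage \<pi>) (dom \<sigma>) (dom (\<sigma> \<circ>\<^sub>m \<pi>))"
proof (rule bij_betwI')
  have ex: "\<pi> (edge_preimage \<pi> f) = Some f" if "f \<in> dom \<sigma>" for f
    using map_edge_preimage[OF assms(2,3)] iso_set_dom[OF assms(1)] that by blast
  show "edge_preimage \<pi> f = edge_preimage \<pi> g \<longleftrightarrow> f = g" if "f \<in> dom \<sigma>" "g \<in> dom \<sigma>" for f g
    using ex that by (metis option.inject)
  show "edge_preimage \<pi> f \<in> dom (\<sigma> \<circ>\<^sub>m \<pi>)" if "f \<in> dom \<sigma>" for f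
    using ex[OF that] that by (auto simp: map_comp_def)
  show "\<exists>f\<in>dom \<sigma>. e = edge_preimage \<pi> f" if "e \<in> dom (\<sigma> \<circ>\<^sub>m \<pi>)" for e
    using that edge_preimage_eq[OF assms(2)]
    by (auto simp: map_comp_def dom_def split: option.splits)
qed

section \<open>Polynomials over a set of variables\<close>

lemma polys_in_Const [simp]: "Const c \<in> polys_in E"
  by (simp add: polys_in_def Const_def)

lemma polys_in_1 [simp]: "1 \<in> polys_in E"
  by (simp add: polys_in_def)

lemma polys_in_Var: "x \<in> E \<Longrightarrow> Var x \<in> polys_in E"
  by (simp add: polys_in_def Var_def)

lemma polys_in_diff:
  assumes "p \<in> polys_in E" "q \<in> polys_in E"
  shows "p - q \<in> polys_in E"
proof -
  have "Poly_Mapping.keys (p - q) \<subseteq> Poly_Mapping.keys p \<union> Poly_Mapping.keys q"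
    by (auto simp: in_keys_iff lookup_minus)
  with assms show ?thesis
    unfolding polys_in_def by blast
qed

lemma polys_in_mult:
  assumes "p \<in> polys_in E" "q \<in> polys_in E"
  shows "p * q \<in> polys_in E"
  unfolding polys_in_def
proof (intro CollectI ballI)
  fix m assume "m \<in> Poly_Mapping.keys (p * q)"
  then obtain a b where "m = a + b" "a \<in> Poly_Mapping.keys p" "b \<in> Poly_Mapping.keys q"
    using keys_mult[of p q] by blast
  then show "Poly_Mapping.keys m \<subseteq> E"
    using assms Poly_Mapping.keys_add[of a b] unfolding polys_in_def by blast
qed

lemma polys_in_power: "p \<in> polys_in E \<Longrightarrow> p ^ n \<in> polys_in E"
  by (induction n) (auto intro: polys_in_mult)

lemma polys_in_prod: "(\<And>i. i \<in> A \<Longrightarrow> f i \<in> polys_in E) \<Longrightarrow> prod f A \<in> polys_in E"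
  by (induction A rule: infinite_finite_induct) (auto intro: polys_in_mult)

section \<open>Substitution is a ring homomorphism\<close>

text \<open>The inner product of \<open>subst_vars\<close> is isolated so that its behaviour under
  addition of exponents can be treated separately.\<close>

definition subst_monom :: "('x \<Rightarrow> 'b::comm_monoid_mult) \<Rightarrow> ('x \<Rightarrow>\<^sub>0 nat) \<Rightarrow> 'b" where
  "subst_monom s m = (\<Prod>x\<in>Poly_Mapping.keys m. s x ^ Poly_Mapping.lookup m x)"

text \<open>Additional variables have exponent 0 and contribute 1, so several monomials can be
  expanded over one common set.\<close>

lemma subst_monom_superset:
  assumes "finite A" "Poly_Mapping.keys m \<subseteq> A"
  shows "subst_monom s m = (\<Prod>x\<in>A. s x ^ Poly_Mapping.lookup m x)"
  unfolding subst_monom_def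
  by (rule prod.mono_neutral_left) (use assms in \<open>auto simp: in_keys_iff\<close>)

lemma subst_monom_add: "subst_monom s (m + m') = subst_monom s m * subst_monom s m'"
proof -
  let ?A = "Poly_Mapping.keys m \<union> Poly_Mapping.keys m'"
  have "subst_monom s (m + m') = (\<Prod>x\<in>?A. s x ^ Poly_Mapping.lookup (m + m') x)"
    using Poly_Mapping.keys_add[of m m'] by (intro subst_monom_superset) auto
  also have "\<dots> = subst_monom s m * subst_monom s m'"
    by (simp add: lookup_add power_add prod.distrib subst_monom_superset[of ?A])
  finally show ?thesis .
qed

lemma Const_0 [simp]: "Const 0 = 0"
  by (simp add: Const_def)

lemma Const_1: "Const 1 = 1"
  by (simp add: Const_def)

lemma Const_add: "Const (a + b) = Const a + Const b"
  by (simp add: Const_def single_add)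

lemma Const_mult: "Const (a * b) = Const a * Const b"
  by (simp add: Const_def mult_single)

text \<open>Additional monomials have coefficient 0. A common index set is needed because
  cancellation can make the keys of a sum smaller than the union of the keys.\<close>

lemma subst_vars_superset:
  assumes "finite A" "Poly_Mapping.keys p \<subseteq> A"
  shows "subst_vars s p = (\<Sum>m\<in>A. Const (Poly_Mapping.lookup p m) * subst_monom s m)"
  unfolding subst_vars_def subst_monom_def
  by (rule sum.mono_neutral_left) (use assms in \<open>auto simp: in_keys_iff\<close>)

lemma subst_vars_single:
  "subst_vars s (Poly_Mapping.single m c) = Const c * subst_monom s m"
  \<comment> \<open>The set \<open>{m}\<close> also covers \<open>c = 0\<close>, where there are no
    keys.\<close>
  by (subst subst_vars_superset[of "{m}"]) auto

lemma subst_vars_0 [simp]: "subst_vars s 0 = 0"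
  by (simp add: subst_vars_def)

lemma subst_vars_add: "subst_vars s (p + q) = subst_vars s p + subst_vars s q"
proof -
  let ?A = "Poly_Mapping.keys p \<union> Poly_Mapping.keys q"
  have "subst_vars s (p + q) =
      (\<Sum>m\<in>?A. Const (Poly_Mapping.lookup (p + q) m) * subst_monom s m)"
    using Poly_Mapping.keys_add[of p q] by (intro subst_vars_superset) auto
  also have "\<dots> = subst_vars s p + subst_vars s q"
    by (simp add: lookup_add Const_add distrib_right sum.distrib subst_vars_superset[of ?A])
  finally show ?thesis .
qed

lemma subst_vars_diff: "subst_vars s (p - q) = subst_vars s p - subst_vars s q"
  using subst_vars_add[of s "p - q" q] by (simp add: algebra_simps)

lemma subst_vars_sum: "subst_vars s (sum f A) = (\<Sum>i\<in>A. subst_vars s (f i))"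
  by (induction A rule: infinite_finite_induct) (auto simp: subst_vars_add)

lemma poly_mapping_sum_single:
  "(\<Sum>m\<in>Poly_Mapping.keys p. Poly_Mapping.single m (Poly_Mapping.lookup p m)) = p"
  by (rule poly_mapping_eqI) (simp add: lookup_sum lookup_single when_def in_keys_iff)

text \<open>Both factors are expanded into single terms; by additivity it suffices to treat two
  terms, where exponents add and coefficients multiply.\<close>

lemma subst_vars_mult: "subst_vars s (p * q) = subst_vars s p * subst_vars s q"
proof -
  let ?t = "\<lambda>p m. Poly_Mapping.single m (Poly_Mapping.lookup p m)"
  have "subst_vars s (?t p m * ?t q m') = subst_vars s (?t p m) * subst_vars s (?t q m')" for m m'
    by (simp add: mult_single subst_vars_single Const_mult subst_monom_add mult_ac)
  then have "subst_vars s ((\<Sum>m\<in>Poly_Mapping.keys p. ?t p m) * (\<Sum>m\<in>Poly_Mapping.keys q. ?t q m)) =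
      subst_vars s (\<Sum>m\<in>Poly_Mapping.keys p. ?t p m) * subst_vars s (\<Sum>m\<in>Poly_Mapping.keys q. ?t q m)"
    by (simp only: sum_product subst_vars_sum)
  then show ?thesis
    by (simp only: poly_mapping_sum_single)
qed

lemma subst_vars_Const [simp]: "subst_vars s (Const c) = Const c"
  unfolding Const_def subst_vars_single by (simp add: Const_def subst_monom_def)

lemma subst_vars_1 [simp]: "subst_vars s 1 = 1"
  using subst_vars_Const[of s 1] by (simp add: Const_1)

lemma subst_vars_Var [simp]: "subst_vars s (Var x) = s x"
  unfolding Var_def subst_vars_single by (simp add: Const_1 subst_monom_def)

lemma subst_vars_power: "subst_vars s (p ^ n) = subst_vars s p ^ n"
  by (induction n) (auto simp: subst_vars_mult)

lemma subst_vars_prod: "subst_vars s (prod f A) = (\<Prod>i\<in>A. subst_vars s (f i))"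
  by (induction A rule: infinite_finite_induct) (auto simp: subst_vars_mult)

section \<open>Indicator polynomials\<close>

text \<open>The cofactor is the product of cofactors chosen for each index.\<close>

lemma factor_in_prod:
  assumes "\<And>i. i \<in> A \<Longrightarrow> factor_in E (f i) (g i)"
  shows "factor_in E (prod f A) (prod g A)"
proof -
  obtain s where s: "\<And>i. i \<in> A \<Longrightarrow> s i \<in> polys_in E" "\<And>i. i \<in> A \<Longrightarrow> g i = f i * s i"
    using assms unfolding factor_in_def by metis
  then have "prod g A = prod f A * prod s A"
    by (simp add: prod.distrib)
  then show ?thesis
    using assms s(1) unfolding factor_in_def by (blast intro: polys_in_prod)
qed

lemma factor_in_prod_subset:
  assumes "finite B" "A \<subseteq> B" "\<And>i. i \<in> B \<Longrightarrow> f i \<in> polys_in E"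
  shows "factor_in E (prod f A) (prod f B)"
proof -
  have "prod f B = prod f A * prod f (B - A)"
    using prod.subset_diff[OF assms(2,1), of f] by (simp add: mult.commute)
  moreover have "prod f A \<in> polys_in E" "prod f B \<in> polys_in E" "prod f (B - A) \<in> polys_in E"
    using assms(2,3) by (blast intro: polys_in_prod)+
  ultimately show ?thesis
    unfolding factor_in_def by blast
qed

text \<open>By Fermat's little theorem in the finite field, this vanishes at a colouring exactly
  when the colouring agrees with \<psi> after \<pi> on \<open>dom \<pi>\<close>. It does not mention
  the ambient graph, so factors arising from \<open>H\<close> and from \<open>G\<close> can be
  compared directly.\<close>

definition indicator_factor ::
    "('v set \<rightharpoonup> 'w set) \<Rightarrow> ('w set \<Rightarrow> 'a::{field,finite}) \<Rightarrow> ('v set, 'a) mpoly" where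
  "indicator_factor \<pi> \<psi> =
     1 - (\<Prod>e\<in>dom \<pi>. 1 - (Var e - Const (\<psi> (the (\<pi> e)))) ^ (CARD('a) - 1))"

lemma indicator_poly_eq: "indicator_poly G X \<psi> = (\<Prod>\<pi>\<in>iso_set G X. indicator_factor \<pi> \<psi>)"
  by (simp add: indicator_poly_def indicator_factor_def)

lemma polys_in_indicator_factor: "dom \<pi> \<subseteq> E \<Longrightarrow> indicator_factor \<pi> \<psi> \<in> polys_in E"
  unfolding indicator_factor_def
  by (intro polys_in_diff polys_in_1 polys_in_prod polys_in_power polys_in_Var polys_in_Const) auto

text \<open>Substitution commutes with the ring operations, so only the edge variables are renamed,
  and \<sigma> at \<open>f\<close> is the composite at the preimage of \<open>f\<close>.\<close>

lemma subst_vars_indicator_factor: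
  assumes "\<sigma> \<in> iso_set H X" "\<pi> \<in> iso_set G H" "is_graph H"
  shows "subst_vars (\<lambda>f. Var (edge_preimage \<pi> f)) (indicator_factor \<sigma> \<psi>) =
    indicator_factor (\<sigma> \<circ>\<^sub>m \<pi>) (\<psi> :: 'w set \<Rightarrow> 'a::{field,finite})"
proof -
  let ?h = "\<lambda>e f. 1 - (Var e - Const (\<psi> f)) ^ (CARD('a) - 1)"
  have "(\<sigma> \<circ>\<^sub>m \<pi>) (edge_preimage \<pi> f) = \<sigma> f" if "f \<in> dom \<sigma>" for f
    using map_edge_preimage[OF assms(2,3)] iso_set_dom[OF assms(1)] that
    by (auto simp: map_comp_def subset_iff)
  \<comment> \<open>The colour is rewritten as a function of the preimage edge alone, the shape
    required for reindexing.\<close>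
  then have "(\<Prod>f\<in>dom \<sigma>. ?h (edge_preimage \<pi> f) (the (\<sigma> f))) =
      (\<Prod>f\<in>dom \<sigma>. ?h (edge_preimage \<pi> f) (the ((\<sigma> \<circ>\<^sub>m \<pi>) (edge_preimage \<pi> f))))"
    by (intro prod.cong) auto
  also have "\<dots> = (\<Prod>e\<in>dom (\<sigma> \<circ>\<^sub>m \<pi>). ?h e (the ((\<sigma> \<circ>\<^sub>m \<pi>) e)))"
    by (rule prod.reindex_bij_betw[OF bij_betw_edge_preimage_comp[OF assms]])
  finally show ?thesis
    by (simp add: indicator_factor_def subst_vars_diff subst_vars_prod subst_vars_power)
qed

lemma factor_in_subst_indicator_poly:
  assumes "\<pi> \<in> iso_set G H" "is_graph G" "is_graph H" "is_graph X"
  shows "factor_in (edges G)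
    (subst_vars (\<lambda>f. Var (edge_preimage \<pi> f)) (indicator_poly H X \<psi>)) (indicator_poly G X \<psi>)"
proof -
  let ?c = "\<lambda>\<sigma>. \<sigma> \<circ>\<^sub>m \<pi>"
  have "subst_vars (\<lambda>f. Var (edge_preimage \<pi> f)) (indicator_poly H X \<psi>) =
      (\<Prod>\<sigma>\<in>iso_set H X. indicator_factor (?c \<sigma>) \<psi>)"
    unfolding indicator_poly_eq subst_vars_prod
    by (rule prod.cong[OF refl subst_vars_indicator_factor]) (use assms in auto)
  \<comment> \<open>Injectivity of \<open>?c\<close> ensures that no two factors are merged when the
    product passes to the image.\<close>
  also have "\<dots> = (\<Prod>\<tau>\<in>?c ` iso_set H X. indicator_factor \<tau> \<psi>)"
    using inj_on_iso_set_comp[OF assms(1,3), of X] by (simp add: prod.reindex)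
  also have "factor_in (edges G) \<dots> (indicator_poly G X \<psi>)"
    unfolding indicator_poly_eq
  proof (rule factor_in_prod_subset)
    show "finite (iso_set G X)"
      using assms(2,4) by (rule finite_iso_set)
    show "?c ` iso_set H X \<subseteq> iso_set G X"
      using assms(1) by (auto intro: iso_set_comp)
  qed (rule polys_in_indicator_factor[OF iso_set_dom])
  finally show ?thesis .
qed

theorem theorem2:
  fixes I :: "'i::wellorder set"
    and G :: "'i \<Rightarrow> 'v ugraph"
    and J :: "'j set"
    and X :: "'j \<Rightarrow> 'w ugraph"
    and \<psi> :: "'j \<Rightarrow> 'w set \<Rightarrow> 'a::{field,finite}"
    and k :: 'i
  assumes "I \<noteq> {}"
    and "\<forall>i\<in>I. is_graph (G i)"
    and "hereditary I G"
    and "finite J"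
    and "\<forall>j\<in>J. is_graph (X j)"
    and "\<forall>j\<in>J. \<psi> j \<in> Hom (X j) (UNIV :: 'a set)"
    and "resolution_index I G J X k"
  shows "\<forall>n\<in>I. k < n \<longrightarrow> (\<forall>\<pi>\<in>iso_set (G n) (G k).
           factor_in (edges (G n))
             (subst_vars (\<lambda>f. Var (edge_preimage \<pi> f)) (indicator_poly_family (G k) J X \<psi>))
             (indicator_poly_family (G n) J X \<psi>))"
proof (intro ballI impI)
  fix n \<pi>
  assume "n \<in> I" and \<pi>: "\<pi> \<in> iso_set (G n) (G k)"
  moreover have "k \<in> I"
    using assms(7) by (simp add: resolution_index_def Let_def)
  ultimately have "is_graph (G n)" "is_graph (G k)"
    using assms(2) by auto
  then show "factor_in (edges (G n))
      (subst_vars (\<lambda>f. Var (edge_preimage \<pi> f)) (indicator_poly_family (G k) J X \<psi>))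
      (indicator_poly_family (G n) J X \<psi>)"
    \<comment> \<open>Substitution distributes over the product over \<open>J\<close>, so
      divisibility can be proved for each \<open>X j\<close> with the same \<pi>.\<close>
    unfolding indicator_poly_family_def subst_vars_prod
    using \<pi> assms(5) by (intro factor_in_prod factor_in_subst_indicator_poly) auto
qed

end
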